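(* Let $N\ge1$, let $\varepsilon_0,\varepsilon_1>0$ and $\beta\in\mathbb C$ with $\operatorname{Im}\beta\neq0$. Let $\boldsymbol{S}_{k_0},\boldsymbol{S}_{k_1},\boldsymbol{D}_{k_0},\boldsymbol{D}^*_{k_0},\boldsymbol{D}^*_{k_1},\boldsymbol{N}_{k_0}\in\mathbb C^{N\times N}$ be the discretized boundary integral operators, $\boldsymbol{I}$ the $N\times N$ identity matrix, and $\boldsymbol{u}^{\mathrm{in}},\boldsymbol{q}^{\mathrm{in}}\in\mathbb C^N$. Put $$M_{13}=-\boldsymbol{S}_{k_1},\quad M_{23}=-\tfrac{1}{\varepsilon_1}\left(\boldsymbol{D}^*_{k_1}+\tfrac{1}{2}\boldsymbol{I}\right),\quad M_{31}=\boldsymbol{D}_{k_0}-\tfrac{1}{2}\boldsymbol{I}+\beta\boldsymbol{N}_{k_0},$$ $$M_{32}=-\varepsilon_0\left\{\boldsymbol{S}_{k_0}+\beta\left(\boldsymbol{D}^*_{k_0}+\tfrac{1}{2}\boldsymbol{I}\right)\right\},\quad b_3=-\boldsymbol{u}^{\mathrm{in}}-\beta\boldsymbol{q}^{\mathrm{in}},$$ and consider the $3N\times3N$ linear system (the discretized direct-indirect Burton--Miller equation) $$\begin{bmatrix} \boldsymbol{I} & 0 & M_{13} \\ 0 & \boldsymbol{I} & M_{23} \\ M_{31} & M_{32} & 0 \end{bmatrix} \begin{bmatrix} \boldsymbol{u} \\ \boldsymbol{q} \\ \boldsymbol{\varphi} \end{bmatrix} = \begin{bmatrix} 0 \\ 0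 \\ b_3 \end{bmatrix},\qquad \boldsymbol{u},\boldsymbol{q},\boldsymbol{\varphi}\in\mathbb C^N.$$ Assume that its coefficient matrix is invertible. Then the solution is given by $$\begin{bmatrix} \boldsymbol{u} \\ \boldsymbol{q} \\ \boldsymbol{\varphi} \end{bmatrix} = \begin{bmatrix} -M_{13}x_3 \\ -M_{23}x_3 \\ x_3 \end{bmatrix},\qquad x_3=(-M_{31}M_{13}-M_{32}M_{23})^{-1}b_3.$$ This solution procedure requires approximately (i.e. to leading order in $N$) $\frac{14}{3}N^3$ floating-point operations.
   Context: The matrices $\boldsymbol{S}_k,\boldsymbol{D}_k,\boldsymbol{D}^*_k,\boldsymbol{N}_k\in\mathbb C^{N\times N}$ arise from a Nyström discretization (with a zeta-corrected trapezoidal quadrature on $N$ equispaced parameter points) of the single-layer, double-layer, adjoint double-layer and hypersingular Helmholtz boundary integral operators on a closed curve with wavenumber $k$, where $k_i=\omega\sqrt{\varepsilon_i}$, $\omega>0$, $i=0,1$; $\boldsymbol{u}^{\mathrm{in}},\boldsymbol{q}^{\mathrm{in}}$ are the vectors of values of the incident field and of its normal derivative at these points. No property of the entries of these matrices is assumed in the statement beyond their being complex $N\times N$ matrices such that the block coefficient matrix is invertible. Operation count: the solution procedure is the evaluation of the displayed formulas, i.e. forming the $N\times N$ matrix $-M_{31}M_{13}-M_{32}M_{23}$, obtaining $x_3$ by LU factorization of this matrix and triangular solves with right-hand side $b_3$, and computing $-M_{13}x_3$ and $-M_{23}x_3$. Only the coefficient of $N^3$ is counted, with the standard conventions that a product of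 two $N\times N$ matrices costs $2N^3$ floating-point operations and that LU factorization of an $N\times N$ matrix costs $\frac{2}{3}N^3$ floating-point operations to leading order. *)

theory Defs
  imports
    Complex_Main
    "HOL-Library.Landau_Symbols"
    "HOL-Library.State_Monad"
    "Jordan_Normal_Form.Matrix"
    "Jordan_Normal_Form.Gauss_Jordan_Elimination"
begin

definition append_cols :: "'a :: zero mat \<Rightarrow> 'a mat \<Rightarrow> 'a mat" (infixr \<open>@\<^sub>c\<close> 66) where
  "A @\<^sub>c B = four_block_mat A B (0\<^sub>m 0 (dim_col A)) (0\<^sub>m 0 (dim_col B))"

definition block_system_mat ::
  "nat \<Rightarrow> complex mat \<Rightarrow> complex mat \<Rightarrow> complex mat \<Rightarrow> complex mat \<Rightarrow> complex mat" where
  "block_system_mat N M13 M23 M31 M32 =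
     (1\<^sub>m N   @\<^sub>c 0\<^sub>m N N @\<^sub>c M13) @\<^sub>r
     (0\<^sub>m N N @\<^sub>c 1\<^sub>m N   @\<^sub>c M23) @\<^sub>r
     (M31     @\<^sub>c M32     @\<^sub>c 0\<^sub>m N N)"

text \<open>
  Floating-point operations are counted by running the textbook algorithms, over exact complex
  numbers, in a state monad whose state is the number of operations performed so far. Each complex
  addition, subtraction, negation, multiplication or division is wrapped in \<open>flop\<close> and counts as one
  operation; copying entries, swapping rows and comparing moduli in the pivot search are free.
\<close>

type_synonym 'a flops = "(nat, 'a) state"

definition flop :: "complex \<Rightarrow> complex flops" where
  "flop z = do { State_Monad.update Suc; State_Monad.return z }"

primrec for_loop :: "'i list \<Rightarrow> ('i \<Rightarrow> 'a \<Rightarrow> 'a flops) \<Rightarrow> 'a \<Rightarrow> 'a flops" where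
  "for_loop [] body a = State_Monad.return a"
| "for_loop (i # is) body a = do { a' \<leftarrow> body i a; for_loop is body a' }"

definition mat_mul :: "nat \<Rightarrow> complex mat \<Rightarrow> complex mat \<Rightarrow> complex mat flops" where
  "mat_mul N A B =
     for_loop [0..<N] (\<lambda>i. for_loop [0..<N] (\<lambda>j C. do {
       s \<leftarrow> for_loop [0..<N] (\<lambda>k s. do { t \<leftarrow> flop (A $$ (i,k) * B $$ (k,j)); flop (s + t) }) 0;
       State_Monad.return (C |\<^sub>m (i,j) \<mapsto> s)
     })) (0\<^sub>m N N)"

definition neg_sub_mat :: "nat \<Rightarrow> complex mat \<Rightarrow> complex mat \<Rightarrow> complex mat flops" where
  "neg_sub_mat N A B =
     for_loop [0..<N] (\<lambda>i. for_loop [0..<N] (\<lambda>j C. do {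
       s \<leftarrow> flop (- (A $$ (i,j)));
       t \<leftarrow> flop (s - B $$ (i,j));
       State_Monad.return (C |\<^sub>m (i,j) \<mapsto> t)
     })) (0\<^sub>m N N)"

definition neg_mat_vec_mul :: "nat \<Rightarrow> complex mat \<Rightarrow> complex vec \<Rightarrow> complex vec flops" where
  "neg_mat_vec_mul N A x =
     for_loop [0..<N] (\<lambda>i y. do {
       s \<leftarrow> for_loop [0..<N] (\<lambda>j s. do { t \<leftarrow> flop (A $$ (i,j) * x $ j); flop (s + t) }) 0;
       r \<leftarrow> flop (- s);
       State_Monad.return (y |\<^sub>v i \<mapsto> r)
     }) (0\<^sub>v N)"

text \<open>
  In-place right-looking LU factorization with partial pivoting. In the result \<open>(W, p)\<close>, the part of
  \<open>W\<close> strictly below the diagonal stores the unit lower triangular factor, the rest of \<open>W\<close> stores the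
  upper triangular factor, and row \<open>i\<close> of their product is row \<open>p i\<close> of the input matrix.
\<close>

definition pivot_row :: "nat \<Rightarrow> complex mat \<Rightarrow> nat \<Rightarrow> nat" where
  "pivot_row N W k = (ARG_MAX (\<lambda>i. cmod (W $$ (i,k))) i. i \<in> {k..<N})"

definition eliminate_row :: "nat \<Rightarrow> nat \<Rightarrow> nat \<Rightarrow> complex mat \<Rightarrow> complex mat flops" where
  "eliminate_row N k i W = do {
     l \<leftarrow> flop (W $$ (i,k) / W $$ (k,k));
     for_loop [Suc k..<N] (\<lambda>j W. do {
       t \<leftarrow> flop (l * W $$ (k,j));
       w \<leftarrow> flop (W $$ (i,j) - t);
       State_Monad.return (W |\<^sub>m (i,j) \<mapsto> w)
     }) (W |\<^sub>m (i,k) \<mapsto> l)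
   }"

definition lu_factor :: "nat \<Rightarrow> complex mat \<Rightarrow> (complex mat \<times> (nat \<Rightarrow> nat)) flops" where
  "lu_factor N A =
     for_loop [0..<N] (\<lambda>k (W, p).
       let r = pivot_row N W k in do {
         W' \<leftarrow> for_loop [Suc k..<N] (eliminate_row N k) (swaprows k r W);
         State_Monad.return (W', p(k := p r, r := p k))
       }) (A, id)"

definition forward_subst :: "nat \<Rightarrow> complex mat \<Rightarrow> complex vec \<Rightarrow> complex vec flops" where
  "forward_subst N W b =
     for_loop [0..<N] (\<lambda>i. for_loop [0..<i] (\<lambda>j y. do {
       t \<leftarrow> flop (W $$ (i,j) * y $ j);
       s \<leftarrow> flop (y $ i - t);
       State_Monad.return (y |\<^sub>v i \<mapsto> s)
     })) b"

definition back_subst :: "nat \<Rightarrow> complex mat \<Rightarrow> complex vec \<Rightarrow> complex vec flops" where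
  "back_subst N W y =
     for_loop (rev [0..<N]) (\<lambda>i x. do {
       x' \<leftarrow> for_loop [Suc i..<N] (\<lambda>j x. do {
         t \<leftarrow> flop (W $$ (i,j) * x $ j);
         s \<leftarrow> flop (x $ i - t);
         State_Monad.return (x |\<^sub>v i \<mapsto> s)
       }) x;
       d \<leftarrow> flop (x' $ i / W $$ (i,i));
       State_Monad.return (x' |\<^sub>v i \<mapsto> d)
     }) y"

definition lu_solve :: "nat \<Rightarrow> complex mat \<Rightarrow> complex vec \<Rightarrow> complex vec flops" where
  "lu_solve N A b = do {
     Wp \<leftarrow> lu_factor N A;
     y \<leftarrow> forward_subst N (fst Wp) (vec N (\<lambda>i. b $ snd Wp i));
     back_subst N (fst Wp) y
   }"

definition solution_procedure ::
  "nat \<Rightarrow> complex mat \<Rightarrow> complex mat \<Rightarrow> complex mat \<Rightarrow> complex mat \<Rightarrow> complex vec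
     \<Rightarrow> (complex vec \<times> complex vec \<times> complex vec) flops" where
  "solution_procedure N M13 M23 M31 M32 b3 = do {
     P \<leftarrow> mat_mul N M31 M13;
     Q \<leftarrow> mat_mul N M32 M23;
     K \<leftarrow> neg_sub_mat N P Q;
     x3 \<leftarrow> lu_solve N K b3;
     u \<leftarrow> neg_mat_vec_mul N M13 x3;
     q \<leftarrow> neg_mat_vec_mul N M23 x3;
     State_Monad.return (u, q, x3)
   }"

text \<open>
  The operation counts of the two cubic building blocks agree with the standard conventions.
\<close>

lemma run_state_update [simp]: "run_state (State_Monad.update f) c = ((), f c)"
  by (simp add: State_Monad.update_def)

lemma snd_run_bind:
  "snd (run_state (State_Monad.bind m f) c) =
     snd (run_state (f (fst (run_state m c))) (snd (run_state m c)))"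
  by (simp add: case_prod_beta)

lemma run_flop [simp]: "run_state (flop z) c = (z, Suc c)"
  by (simp add: flop_def)

lemma for_loop_flops:
  assumes "\<And>i a c. i \<in> set is \<Longrightarrow> snd (run_state (body i a) c) = c + g i"
  shows "snd (run_state (for_loop is body a) c) = c + (\<Sum>i\<leftarrow>is. g i)"
  using assms
  by (induction "is" arbitrary: a c) (simp_all add: snd_run_bind del: run_state_bind)

lemma mat_mul_flops: "snd (run_state (mat_mul N A B) 0) = 2 * N ^ 3"
proof -
  have inner: "snd (run_state (for_loop [0..<N]
      (\<lambda>k s. do { t \<leftarrow> flop (A $$ (i,k) * B $$ (k,j)); flop (s + t) }) s) c) = c + 2 * N" for i j s c
    by (subst for_loop_flops[where g = "\<lambda>_. 2"]) (simp_all add: sum_list_triv)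
  show ?thesis
    unfolding mat_mul_def
    apply (subst for_loop_flops[where g = "\<lambda>_. N * (2 * N)"])
     apply (subst for_loop_flops[where g = "\<lambda>_. 2 * N"])
    by (simp_all add: snd_run_bind inner sum_list_triv power3_eq_cube del: run_state_bind)
qed

lemma lu_factor_flops:
  "real (snd (run_state (lu_factor N A) 0)) = 2/3 * real N ^ 3 - 1/2 * real N ^ 2 - 1/6 * real N"
proof -
  have row: "snd (run_state (eliminate_row N k i W) c) = c + (1 + 2 * (N - Suc k))" for k i W c
    unfolding eliminate_row_def snd_run_bind
    by (subst for_loop_flops[where g = "\<lambda>_. 2"]) (simp_all add: sum_list_triv)
  have rows: "snd (run_state (for_loop [Suc k..<N] (eliminate_row N k) W) c) =
      c + (N - Suc k) * (1 + 2 * (N - Suc k))" for k W c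
    by (subst for_loop_flops[where g = "\<lambda>_. 1 + 2 * (N - Suc k)"]) (simp_all add: row sum_list_triv)
  have sum: "real (\<Sum>m<N. m * (1 + 2 * m)) = 2/3 * real N ^ 3 - 1/2 * real N ^ 2 - 1/6 * real N"
    by (induction N) (simp_all add: field_simps power2_eq_square power3_eq_cube)
  have "snd (run_state (lu_factor N A) 0) = (\<Sum>k\<leftarrow>[0..<N]. (N - Suc k) * (1 + 2 * (N - Suc k)))"
    unfolding lu_factor_def
    by (subst for_loop_flops[where g = "\<lambda>k. (N - Suc k) * (1 + 2 * (N - Suc k))"])
      (simp_all add: snd_run_bind rows Let_def case_prod_beta del: run_state_bind)
  also have "\<dots> = (\<Sum>k<N. (N - Suc k) * (1 + 2 * (N - Suc k)))"
    by (simp add: sum_list_distinct_conv_sum_set atLeast0LessThan)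
  also have "\<dots> = (\<Sum>m<N. m * (1 + 2 * m))"
    by (rule sum.nat_diff_reindex)
  finally show ?thesis using sum by simp
qed

end

theory Submission
  imports Defs "Jordan_Normal_Form.Determinant" "HOL-Real_Asymp.Real_Asymp"
begin

text \<open>
  The first two block rows express \<open>u\<close> and \<open>q\<close> through \<open>\<phi>\<close>, and substituting into the third leaves
  \<open>K \<phi> = b\<^sub>3\<close> with the Schur complement \<open>K\<close>. A kernel vector of \<open>K\<close> extends to one of the block
  matrix, so \<open>K\<close> is invertible. The LU loop maintains a partially computed factorization of the
  row-permuted matrix; comparing determinants shows that all its pivots are nonzero, so the
  triangular solves return \<open>K\<^sup>-\<^sup>1 b\<^sub>3\<close>. The cubic terms of the operation count come only from the two
  matrix products and the factorization: \<open>2 + 2 + 2/3 = 14/3\<close>.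
\<close>

section \<open>Loops with exact operation counts\<close>

text \<open>The result is chosen before the initial counter \<open>c\<close>, so it cannot depend on
  it, and \<open>n\<close> is an exact cost rather than a bound. A predicate for the result admits
  loop invariants that do not determine the state, as needed for LU factorization and the triangular
  solves.\<close>

definition computes :: "'a flops \<Rightarrow> nat \<Rightarrow> ('a \<Rightarrow> bool) \<Rightarrow> bool" where
  "computes m n P \<longleftrightarrow> (\<exists>a. P a \<and> (\<forall>c. run_state m c = (a, c + n)))"

lemma computes_return: "P a \<Longrightarrow> computes (State_Monad.return a) 0 P"
  by (simp add: computes_def)

lemma computes_flop: "P z \<Longrightarrow> computes (flop z) 1 P"
  by (simp add: computes_def)

lemma computes_bind:
  assumes "computes m n P" "\<And>a. P a \<Longrightarrow> computes (f a) n' Q" "k = n + n'"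
  shows "computes (State_Monad.bind m f) k Q"
proof -
  obtain a where a: "P a" "\<And>c. run_state m c = (a, c + n)"
    using assms(1) by (auto simp: computes_def)
  obtain b where "Q b" "\<And>c. run_state (f a) c = (b, c + n')"
    using assms(2)[OF a(1)] by (auto simp: computes_def)
  then show ?thesis
    using a(2) assms(3) by (auto simp: computes_def add.assoc)
qed

lemma computes_flop_bind:
  assumes "computes (f z) n Q" "k = Suc n"
  shows "computes (State_Monad.bind (flop z) f) k Q"
  by (rule computes_bind[OF computes_flop[where P = "\<lambda>a. a = z"]]) (use assms in auto)

lemma computes_mono:
  assumes "computes m n P" "\<And>a. P a \<Longrightarrow> Q a" "k = n"
  shows "computes m k Q"
  using assms by (auto simp: computes_def)

lemma computes_eqD: "computes m n (\<lambda>a. a = b) \<Longrightarrow> run_state m c = (b, c + n)"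
  by (auto simp: computes_def)

text \<open>A Hoare rule: \<open>P i\<close> holds just before iteration \<open>i\<close>. The cost
  \<open>g i\<close> depends on the index only and not on the loop state, which is why the costs
  simply add up.\<close>

lemma computes_for_loop_upt:
  assumes "l \<le> u" "P l a"
    and "\<And>i a. l \<le> i \<Longrightarrow> i < u \<Longrightarrow> P i a \<Longrightarrow> computes (body i a) (g i) (P (Suc i))"
  shows "computes (for_loop [l..<u] body a) (\<Sum>i=l..<u. g i) (P u)"
  using assms
proof (induction "u - l" arbitrary: l a)
  case 0
  then show ?case by (simp add: computes_return)
next
  case (Suc d)
  then have lu: "l < u" by simp
  have "computes (body l a) (g l) (P (Suc l))"
    using Suc lu by simp
  then show ?case
    unfolding upt_conv_Cons[OF lu] for_loop.simps
    by (rule computes_bind[where n' = "\<Sum>i=Suc l..<u. g i"])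
      (use Suc lu in \<open>simp_all add: sum.atLeast_Suc_lessThan\<close>)
qed

text \<open>The counterpart for descending loops: \<open>P (Suc i)\<close> holds before iteration
  \<open>i\<close> and \<open>P i\<close> after it, so the final state satisfies
  \<open>P 0\<close>.\<close>

lemma computes_for_loop_rev_upt:
  assumes "P n a"
    and "\<And>i a. i < n \<Longrightarrow> P (Suc i) a \<Longrightarrow> computes (body i a) (g i) (P i)"
  shows "computes (for_loop (rev [0..<n]) body a) (\<Sum>i<n. g i) (P 0)"
  using assms
proof (induction n arbitrary: a)
  case 0
  then show ?case by (simp add: computes_return)
next
  case (Suc n)
  have "computes (body n a) (g n) (P n)"
    using Suc by simp
  then show ?case
    unfolding upt_Suc_append[OF le0] rev_append rev.simps append.simps for_loop.simps
    by (rule computes_bind[where n' = "\<Sum>i<n. g i"])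
      (use Suc in simp_all)
qed

section \<open>Matrix products and matrix-vector products\<close>

lemma computes_dot_loop:
  "computes (for_loop [0..<N] (\<lambda>k s. do { t \<leftarrow> flop (a k * b k); flop (s + t) }) 0) (2 * N)
     (\<lambda>s. s = (\<Sum>k<N. a k * b k))"
  \<comment> \<open>The addition to the initial 0 is counted as well, hence \<open>2 * N\<close>
    operations and not one fewer.\<close>
  by (rule computes_mono[OF computes_for_loop_upt[where P = "\<lambda>m s. s = (\<Sum>k<m. a k * b k)"
        and g = "\<lambda>_. 2"]])
    (auto intro!: computes_flop_bind computes_flop[unfolded One_nat_def])

lemma computes_fill_mat:
  assumes "\<And>i j C. i < N \<Longrightarrow> j < N \<Longrightarrow> computes (body i j C) n (\<lambda>C'. C' = C |\<^sub>m (i,j) \<mapsto> F i j)"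
  shows "computes (for_loop [0..<N] (\<lambda>i. for_loop [0..<N] (body i)) (0\<^sub>m N N)) (N * (N * n))
     (\<lambda>C. C = mat N N (\<lambda>(i,j). F i j))"
proof -
  \<comment> \<open>All entries before \<open>(i,j)\<close> in lexicographic order are filled. A
    finished row \<open>?Q i N\<close> describes the same matrix as
    \<open>?Q (Suc i) 0\<close>.\<close>
  let ?Q = "\<lambda>i j C. C = mat N N (\<lambda>(i',j'). if i' < i \<or> i' = i \<and> j' < j then F i' j' else 0)"
  have inner: "computes (for_loop [0..<N] (body i) C) (N * n) (?Q i N)"
    if "i < N" "?Q i 0 C" for i C
    by (rule computes_mono[OF computes_for_loop_upt[where P = "?Q i" and g = "\<lambda>_. n"]])
      (use that in \<open>auto intro!: computes_mono[OF assms] eq_matI simp: update_mat_def\<close>)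
  show ?thesis
    by (rule computes_mono[OF computes_for_loop_upt[where P = "\<lambda>i. ?Q i 0" and g = "\<lambda>_. N * n"]])
      (auto intro!: computes_mono[OF inner] eq_matI)
qed

lemma computes_mat_mul:
  assumes "A \<in> carrier_mat N N" "B \<in> carrier_mat N N"
  shows "computes (mat_mul N A B) (2 * N ^ 3) (\<lambda>C. C = A * B)"
proof -
  let ?F = "\<lambda>i j. \<Sum>k<N. A $$ (i,k) * B $$ (k,j)"
  have "mat N N (\<lambda>(i,j). ?F i j) = A * B"
    using assms by (intro eq_matI) (auto simp: scalar_prod_def atLeast0LessThan)
  then show ?thesis
    unfolding mat_mul_def
    by (intro computes_mono[OF computes_fill_mat[where F = ?F and n = "2 * N"]]
        computes_bind[OF computes_dot_loop])
      (auto intro!: computes_return simp: power3_eq_cube)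
qed

lemma computes_neg_sub_mat:
  assumes "A \<in> carrier_mat N N" "B \<in> carrier_mat N N"
  shows "computes (neg_sub_mat N A B) (2 * N ^ 2) (\<lambda>C. C = - A - B)"
proof -
  let ?F = "\<lambda>i j. - (A $$ (i,j)) - B $$ (i,j)"
  have "mat N N (\<lambda>(i,j). ?F i j) = - A - B"
    using assms by (intro eq_matI) auto
  then show ?thesis
    unfolding neg_sub_mat_def
    by (intro computes_mono[OF computes_fill_mat[where F = ?F and n = 2]]
        computes_flop_bind)
      (auto intro!: computes_return simp: power2_eq_square)
qed

lemma computes_neg_mat_vec_mul:
  assumes "A \<in> carrier_mat N N" "x \<in> carrier_vec N"
  shows "computes (neg_mat_vec_mul N A x) (2 * N ^ 2 + N) (\<lambda>y. y = - (A *\<^sub>v x))"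
proof -
  let ?F = "\<lambda>i. - (\<Sum>j<N. A $$ (i,j) * x $ j)"
  let ?P = "\<lambda>m y. y = vec N (\<lambda>i. if i < m then ?F i else 0)"
  have "?P N = (\<lambda>y. y = - (A *\<^sub>v x))"
    using assms by (auto intro!: ext arg_cong2[where f = "(=)"] eq_vecI simp: scalar_prod_def atLeast0LessThan)
  moreover have "computes (neg_mat_vec_mul N A x) (2 * N ^ 2 + N) (?P N)"
    unfolding neg_mat_vec_mul_def
    by (rule computes_mono[OF computes_for_loop_upt[where P = ?P and g = "\<lambda>_. 2 * N + 1"]])
      (auto intro!: computes_bind[OF computes_dot_loop] computes_flop_bind computes_return eq_vecI
        simp: update_vec_def power2_eq_square algebra_simps)
  ultimately show ?thesis by simp
qed

section \<open>LU factorization and triangular solves\<close>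

lemma computes_forward_subst:
  assumes "b \<in> carrier_vec N"
  shows "computes (forward_subst N W b) (\<Sum>i<N. 2 * i)
    (\<lambda>y. y \<in> carrier_vec N \<and> (\<forall>i<N. (\<Sum>j<i. W $$ (i,j) * y $ j) + y $ i = b $ i))"
proof -
  \<comment> \<open>The solve runs in place: rows below \<open>m\<close> satisfy their equation, the
    other entries still hold \<open>b\<close>.\<close>
  let ?P = "\<lambda>m y. y \<in> carrier_vec N \<and>
    (\<forall>i<N. (if i < m then \<Sum>j<i. W $$ (i,j) * y $ j else 0) + y $ i = b $ i)"
  \<comment> \<open>The state after \<open>m\<close> inner iterations, written with the
    \<open>y\<close> at the start of row \<open>i\<close>: the loop changes only entry
    \<open>i\<close> and reads entries \<open>j < i\<close> besides it.\<close>
  let ?upd = "\<lambda>i y m. y |\<^sub>v i \<mapsto> (y $ i - (\<Sum>j<m. W $$ (i,j) * y $ j))"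
  have row: "computes (for_loop [0..<i] (\<lambda>j y. do {
       t \<leftarrow> flop (W $$ (i,j) * y $ j);
       s \<leftarrow> flop (y $ i - t);
       State_Monad.return (y |\<^sub>v i \<mapsto> s) }) y) (2 * i) (\<lambda>y'. y' = ?upd i y i)"
    if "i < N" "y \<in> carrier_vec N" for i y
    by (rule computes_mono[OF computes_for_loop_upt[where P = "\<lambda>m y'. y' = ?upd i y m" and g = "\<lambda>_. 2"]])
      (use that in \<open>auto intro!: computes_flop_bind computes_return eq_vecI simp: update_vec_def\<close>)
  have step: "?P (Suc i) (?upd i y i)" if "i < N" "?P i y" for i y
  proof -
    \<comment> \<open>Rows up to \<open>i\<close> sum over entries strictly before \<open>i\<close>,
      so overwriting entry \<open>i\<close> leaves these sums alone.\<close>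
    have "(\<Sum>j<i'. W $$ (i',j) * ?upd i y i $ j) = (\<Sum>j<i'. W $$ (i',j) * y $ j)" if "i' \<le> i" for i'
      using that by (intro sum.cong) auto
    moreover have "(\<Sum>j<i'. W $$ (i',j) * y $ j) + y $ i' = b $ i'" if "i' < i" for i'
      using \<open>?P i y\<close> \<open>i < N\<close> that by (auto dest!: spec[of _ i'])
    ultimately show ?thesis
      using that by (auto simp: less_Suc_eq update_vec_def)
  qed
  show ?thesis
    unfolding forward_subst_def
  proof (rule computes_mono[OF computes_for_loop_upt[where P = ?P and g = "\<lambda>i. 2 * i"]], goal_cases)
    case (3 i y)
    then show ?case
      using step[of i y] by (intro computes_mono[OF row]) blast+
  qed (use assms in \<open>auto simp: atLeast0LessThan\<close>)
qed

lemma computes_back_subst: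
  assumes "y \<in> carrier_vec N" and diag: "\<And>i. i < N \<Longrightarrow> W $$ (i,i) \<noteq> 0"
  shows "computes (back_subst N W y) (N ^ 2)
    (\<lambda>x. x \<in> carrier_vec N \<and> (\<forall>i<N. (\<Sum>j=i..<N. W $$ (i,j) * x $ j) = y $ i))"
proof -
  \<comment> \<open>The mirror image of the forward invariant: rows from \<open>m\<close> on are
    solved, the entries before \<open>m\<close> still hold \<open>y\<close>.\<close>
  let ?P = "\<lambda>m x. x \<in> carrier_vec N \<and>
    (\<forall>i<N. (if m \<le> i then \<Sum>j=i..<N. W $$ (i,j) * x $ j else x $ i) = y $ i)"
  let ?upd = "\<lambda>i x m. x |\<^sub>v i \<mapsto> (x $ i - (\<Sum>j=Suc i..<m. W $$ (i,j) * x $ j))"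
  let ?new = "\<lambda>i x. x |\<^sub>v i \<mapsto> ((x $ i - (\<Sum>j=Suc i..<N. W $$ (i,j) * x $ j)) / W $$ (i,i))"
  have row: "computes (for_loop [Suc i..<N] (\<lambda>j x. do {
         t \<leftarrow> flop (W $$ (i,j) * x $ j);
         s \<leftarrow> flop (x $ i - t);
         State_Monad.return (x |\<^sub>v i \<mapsto> s) }) x) (2 * (N - Suc i)) (\<lambda>x'. x' = ?upd i x N)"
    if "i < N" "x \<in> carrier_vec N" for i x
    by (rule computes_mono[OF computes_for_loop_upt[where P = "\<lambda>m x'. x' = ?upd i x m" and g = "\<lambda>_. 2"]])
      (use that in \<open>auto intro!: computes_flop_bind computes_return eq_vecI simp: update_vec_def\<close>)
  have step: "?P i (?new i x)" if "i < N" "?P (Suc i) x" for i x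
  proof -
    have x: "dim_vec x = N" using that by auto
    have above: "(\<Sum>j=i'..<N. W $$ (i',j) * ?new i x $ j) = (\<Sum>j=i'..<N. W $$ (i',j) * x $ j)"
      if "i < i'" for i'
      using that by (intro sum.cong) auto
    have diagonal: "(\<Sum>j=i..<N. W $$ (i,j) * ?new i x $ j) = x $ i"
      using \<open>i < N\<close> x diag[of i] by (simp add: sum.atLeast_Suc_lessThan)
    show ?thesis
    proof (intro conjI allI impI)
      fix i' assume "i' < N"
      then have y: "(if Suc i \<le> i' then \<Sum>j=i'..<N. W $$ (i',j) * x $ j else x $ i') = y $ i'"
        using that by blast
      show "(if i \<le> i' then \<Sum>j=i'..<N. W $$ (i',j) * ?new i x $ j else ?new i x $ i') = y $ i'"
      proof (cases i i' rule: linorder_cases)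
        case less
        then show ?thesis using y by (simp only: above less_imp_le Suc_leI if_True)
      next
        case equal
        then have "(if i \<le> i' then \<Sum>j=i'..<N. W $$ (i',j) * ?new i x $ j else ?new i x $ i') = x $ i'"
          using diagonal by (simp only: order_refl if_True)
        then show ?thesis using y equal by simp
      next
        case greater
        then show ?thesis using y by simp
      qed
    qed (rule carrier_vecI, simp only: dim_update_vec x)
  qed
  \<comment> \<open>Row \<open>i\<close> costs two operations per entry to the right of the diagonal
    and one division. In reverse order these are the first \<open>N\<close> odd numbers.\<close>
  have count: "N ^ 2 = (\<Sum>i<N. 2 * (N - Suc i) + 1)"
  proof -
    have "(\<Sum>i<N. 2 * (N - Suc i) + 1) = (\<Sum>i<N. 2 * i + 1)"
      by (rule sum.nat_diff_reindex[where g = "\<lambda>i. 2 * i + 1"])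
    also have "\<dots> = N ^ 2"
      by (induction N) (auto simp: power2_eq_square)
    finally show ?thesis by simp
  qed
  show ?thesis
    unfolding back_subst_def
  proof (rule computes_mono[OF computes_for_loop_rev_upt[where P = ?P and g = "\<lambda>i. 2 * (N - Suc i) + 1"]])
    fix i x assume i: "i < N" and x: "?P (Suc i) x"
    \<comment> \<open>The division overwrites the entry that the inner loop has just written, so the
      two updates collapse into one.\<close>
    have new: "?upd i x N |\<^sub>v i \<mapsto> (?upd i x N $ i / W $$ (i,i)) = ?new i x"
      using i x by (auto intro!: eq_vecI simp: update_vec_def)
    have ret: "computes (State_Monad.return (?upd i x N |\<^sub>v i \<mapsto> (?upd i x N $ i / W $$ (i,i)))) 0 (?P i)"
      unfolding new by (rule computes_return) (rule step[OF i x])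
    show "computes (do {
         x' \<leftarrow> for_loop [Suc i..<N] (\<lambda>j x. do {
           t \<leftarrow> flop (W $$ (i,j) * x $ j);
           s \<leftarrow> flop (x $ i - t);
           State_Monad.return (x |\<^sub>v i \<mapsto> s) }) x;
         d \<leftarrow> flop (x' $ i / W $$ (i,i));
         State_Monad.return (x' |\<^sub>v i \<mapsto> d) }) (2 * (N - Suc i) + 1) (?P i)"
    proof (rule computes_bind[OF row[OF i conjunct1[OF x]]])
      fix x' assume x': "x' = ?upd i x N"
      show "computes (do { d \<leftarrow> flop (x' $ i / W $$ (i,i)); State_Monad.return (x' |\<^sub>v i \<mapsto> d) }) 1 (?P i)"
        unfolding x' by (rule computes_flop_bind, rule ret, simp)
    qed simp
  qed (use assms count in auto)
qed

section \<open>One elimination step\<close>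

definition lu_entry :: "complex mat \<Rightarrow> nat \<Rightarrow> nat \<Rightarrow> nat \<Rightarrow> complex" where
  "lu_entry W k i j = (if j = k then W $$ (i,k) / W $$ (k,k)
     else W $$ (i,j) - W $$ (i,k) / W $$ (k,k) * W $$ (k,j))"

text \<open>\<open>D\<close> is the set of positions already overwritten in step \<open>k\<close>.
  All new entries are expressed through the matrix \<open>W\<close> before the step, so a state
  inside the nested loops is described by \<open>D\<close> alone.\<close>

definition eliminated :: "nat \<Rightarrow> nat \<Rightarrow> (nat \<times> nat) set \<Rightarrow> complex mat \<Rightarrow> complex mat" where
  "eliminated N k D W = mat N N (\<lambda>(i,j). if (i,j) \<in> D then lu_entry W k i j else W $$ (i,j))"

lemma update_eliminated:
  "i < N \<Longrightarrow> j < N \<Longrightarrow>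
     eliminated N k D W |\<^sub>m (i,j) \<mapsto> lu_entry W k i j = eliminated N k (insert (i,j) D) W"
  by (auto simp: eliminated_def update_mat_def intro!: eq_matI)

text \<open>Row \<open>k\<close> is never in the overwritten set and each \<open>(i,j)\<close> is
  written once, so every value read is still the one in \<open>W\<close>. The cost is one division
  for the multiplier and two operations for each column right of \<open>k\<close>.\<close>

lemma computes_eliminate_row:
  assumes "k < i" "i < N"
  shows "computes (eliminate_row N k i (eliminated N k ({k<..<i} \<times> {k..<N}) W)) (1 + 2 * (N - Suc k))
    (\<lambda>W'. W' = eliminated N k ({k<..<Suc i} \<times> {k..<N}) W)"
proof -
  let ?D = "\<lambda>m. {k<..<i} \<times> {k..<N} \<union> {i} \<times> {k..<m}"
  let ?l = "W $$ (i,k) / W $$ (k,k)"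
  let ?W = "eliminated N k ({k<..<i} \<times> {k..<N}) W"
  have D_Suc: "?D (Suc m) = insert (i,m) (?D m)" if "k \<le> m" for m
    using that by auto
  have D_N: "?D N = {k<..<Suc i} \<times> {k..<N}"
    using assms by auto
  have upd: "eliminated N k (?D m) W |\<^sub>m (i,m) \<mapsto> lu_entry W k i m = eliminated N k (?D (Suc m)) W"
    if "k \<le> m" "m < N" for m
    using update_eliminated assms that by (simp add: D_Suc)
  show ?thesis
    unfolding eliminate_row_def
  proof (rule computes_flop_bind)
    show "computes (for_loop [Suc k..<N] (\<lambda>j W'. do {
         t \<leftarrow> flop (?W $$ (i,k) / ?W $$ (k,k) * W' $$ (k,j));
         w \<leftarrow> flop (W' $$ (i,j) - t);
         State_Monad.return (W' |\<^sub>m (i,j) \<mapsto> w)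
       }) (?W |\<^sub>m (i,k) \<mapsto> (?W $$ (i,k) / ?W $$ (k,k))))
       (2 * (N - Suc k)) (\<lambda>W'. W' = eliminated N k ({k<..<Suc i} \<times> {k..<N}) W)"
    proof (rule computes_mono[OF computes_for_loop_upt
          [where P = "\<lambda>m W'. W' = eliminated N k (?D m) W" and g = "\<lambda>_. 2"]], goal_cases)
      \<comment> \<open>Storing the multiplier is the write at column \<open>k\<close>. It turns
        \<open>?D k\<close> into \<open>?D (Suc k)\<close>, where the loop over the remaining
        columns starts.\<close>
      case 2
      show ?case
        using upd[of k] assms by (simp add: lu_entry_def) (simp add: eliminated_def)
    next
      case (3 j W')
      have "eliminated N k (?D j) W |\<^sub>m (i,j) \<mapsto> (W $$ (i,j) - ?l * W $$ (k,j)) = eliminated N k (?D (Suc j)) W"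
        using upd[of j] 3 by (simp add: lu_entry_def)
      moreover have "eliminated N k (?D j) W $$ (i,j) = W $$ (i,j)"
        "eliminated N k (?D j) W $$ (k,j) = W $$ (k,j)"
        "?W $$ (i,k) = W $$ (i,k)" "?W $$ (k,k) = W $$ (k,k)"
        using assms 3 by (simp_all add: eliminated_def)
      ultimately show ?case
        using 3 by (auto intro!: computes_flop_bind computes_return)
    qed (use assms D_N in auto)
  qed simp
qed

lemma computes_eliminate_rows:
  assumes "k < N" "W \<in> carrier_mat N N"
  shows "computes (for_loop [Suc k..<N] (eliminate_row N k) W) ((N - Suc k) * (1 + 2 * (N - Suc k)))
    (\<lambda>W'. W' = eliminated N k ({k<..<N} \<times> {k..<N}) W)"
proof (rule computes_mono[OF computes_for_loop_upt[where
        P = "\<lambda>i W'. W' = eliminated N k ({k<..<i} \<times> {k..<N}) W" and g = "\<lambda>_. 1 + 2 * (N - Suc k)"]],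
    goal_cases)
  \<comment> \<open>At \<open>i = Suc k\<close> the set of finished rows is empty, so
    \<open>eliminated\<close> returns \<open>W\<close> itself.\<close>
  case 2
  show ?case
    using assms by (auto intro!: eq_matI simp: eliminated_def)
next
  case (3 i W')
  then show ?case
    using computes_eliminate_row[of k i N W] by simp
qed (use assms in auto)

lemma pivot_row:
  assumes "k < N"
  shows "k \<le> pivot_row N W k" "pivot_row N W k < N"
    "k \<le> i \<Longrightarrow> i < N \<Longrightarrow> cmod (W $$ (i,k)) \<le> cmod (W $$ (pivot_row N W k, k))"
proof -
  let ?f = "\<lambda>i. cmod (W $$ (i,k))"
  \<comment> \<open>\<open>ARG_MAX\<close> is a choice operator, so a maximizer has to be exhibited
    first; it exists because the candidate set is finite and nonempty.\<close>
  have "Max (?f ` {k..<N}) \<in> ?f ` {k..<N}"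
    using assms by (intro Max_in) auto
  then obtain r where r: "r \<in> {k..<N}" "?f r = Max (?f ` {k..<N})"
    by auto
  have "is_arg_max ?f (\<lambda>i. i \<in> {k..<N}) r"
    using r by (auto simp: is_arg_max_linorder)
  then have "is_arg_max ?f (\<lambda>i. i \<in> {k..<N}) (pivot_row N W k)"
    unfolding pivot_row_def arg_max_def by (rule someI)
  then show "k \<le> pivot_row N W k" "pivot_row N W k < N"
    "k \<le> i \<Longrightarrow> i < N \<Longrightarrow> cmod (W $$ (i,k)) \<le> cmod (W $$ (pivot_row N W k, k))"
    by (auto simp: is_arg_max_linorder)
qed

text \<open>
  After \<open>k\<close> steps, columns \<open>m < k\<close> of \<open>W\<close> below the diagonal hold the multipliers and the block of
  indices \<open>\<ge> k\<close> holds the current Schur complement, so row \<open>i\<close> is complete up to \<open>min k i\<close>.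
\<close>

definition partial_lu :: "nat \<Rightarrow> complex mat \<Rightarrow> nat \<Rightarrow> complex mat \<Rightarrow> (nat \<Rightarrow> nat) \<Rightarrow> bool" where
  "partial_lu N A k W p \<longleftrightarrow> W \<in> carrier_mat N N \<and> p permutes {0..<N} \<and>
     (\<forall>i<N. \<forall>j<N. A $$ (p i, j) =
        (\<Sum>m<min k i. W $$ (i,m) * (if m \<le> j then W $$ (m,j) else 0)) +
        (if min k i \<le> j then W $$ (i,j) else 0))"

text \<open>Both swapped rows have index at least \<open>k\<close>. Hence \<open>min k i\<close> is
  unchanged by the transposition, and the rows \<open>m < k\<close> of the upper factor stay in
  place; the stored multipliers move along with their rows, matching the change of
  \<open>p\<close>.\<close>

lemma partial_lu_swaprows:
  assumes lu: "partial_lu N A k W p" and r: "k \<le> r" "r < N"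
  shows "partial_lu N A k (swaprows k r W) (p(k := p r, r := p k))"
proof -
  let ?t = "Transposition.transpose k r"
  have p': "p(k := p r, r := p k) = p \<circ> ?t"
    by (auto simp: Transposition.transpose_def)
  have W: "W \<in> carrier_mat N N" and p: "p permutes {0..<N}"
    using lu by (auto simp: partial_lu_def)
  have W': "swaprows k r W $$ (i,j) = W $$ (?t i, j)" if "i < N" "j < N" for i j
    using that W by (auto simp: Transposition.transpose_def)
  show ?thesis
    unfolding partial_lu_def p'
  proof (intro conjI allI impI)
    show "p \<circ> ?t permutes {0..<N}"
      using p r by (intro permutes_compose permutes_swap_id) auto
    fix i j assume ij: "i < N" "j < N"
    have t: "?t i < N" "min k (?t i) = min k i"
      using ij r by (auto simp: Transposition.transpose_def)
    have "(\<Sum>m<min k i. swaprows k r W $$ (i,m) * (if m \<le> j then swaprows k r W $$ (m,j) else 0)) =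
      (\<Sum>m<min k i. W $$ (?t i,m) * (if m \<le> j then W $$ (m,j) else 0))"
      using ij r by (intro sum.cong) (auto simp: W')
    then show "A $$ ((p \<circ> ?t) i, j) =
        (\<Sum>m<min k i. swaprows k r W $$ (i,m) * (if m \<le> j then swaprows k r W $$ (m,j) else 0)) +
        (if min k i \<le> j then swaprows k r W $$ (i,j) else 0)"
      using lu ij t by (simp add: partial_lu_def W')
  qed (use W in auto)
qed

text \<open>
  Partial pivoting ensures \<open>piv\<close>, so the step is valid even for a zero pivot: then both
  \<open>W $$ (i,k)\<close> and the stored multiplier, a division by zero, are \<open>0\<close>.
\<close>

lemma partial_lu_eliminated:
  assumes lu: "partial_lu N A k W p" and k: "k < N"
    and piv: "\<And>i. k < i \<Longrightarrow> i < N \<Longrightarrow> W $$ (k,k) = 0 \<Longrightarrow> W $$ (i,k) = 0"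
  shows "partial_lu N A (Suc k) (eliminated N k ({k<..<N} \<times> {k..<N}) W) p"
proof -
  let ?E = "eliminated N k ({k<..<N} \<times> {k..<N}) W"
  have E: "?E $$ (i,j) = (if k < i \<and> k \<le> j then lu_entry W k i j else W $$ (i,j))"
    if "i < N" "j < N" for i j
    using that by (simp add: eliminated_def)
  show ?thesis
    unfolding partial_lu_def
  proof (intro conjI allI impI)
    fix i j assume ij: "i < N" "j < N"
    have A: "A $$ (p i, j) =
        (\<Sum>m<min k i. W $$ (i,m) * (if m \<le> j then W $$ (m,j) else 0)) +
        (if min k i \<le> j then W $$ (i,j) else 0)"
      using lu ij by (simp add: partial_lu_def)
    \<comment> \<open>The sum reads only columns and rows \<open>m < k\<close>, whereas step
      \<open>k\<close> changes only rows below \<open>k\<close> in columns from \<open>k\<close>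
      on.\<close>
    have sum: "(\<Sum>m<min k i. ?E $$ (i,m) * (if m \<le> j then ?E $$ (m,j) else 0)) =
      (\<Sum>m<min k i. W $$ (i,m) * (if m \<le> j then W $$ (m,j) else 0))"
      using ij by (intro sum.cong) (auto simp: E)
    show "A $$ (p i, j) =
        (\<Sum>m<min (Suc k) i. ?E $$ (i,m) * (if m \<le> j then ?E $$ (m,j) else 0)) +
        (if min (Suc k) i \<le> j then ?E $$ (i,j) else 0)"
    proof (cases "i \<le> k")
      case True
      then have "min (Suc k) i = min k i" by simp
      then show ?thesis
        using True A sum ij by (simp add: E)
    next
      case False
      then have mins: "min (Suc k) i = Suc k" "min k i = k" by auto
      \<comment> \<open>The new summand \<open>m = k\<close> restores what elimination subtracted
        when \<open>j > k\<close>, and replaces the cleared entry when \<open>j = k\<close>. The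
        latter needs multiplier times pivot to be \<open>W $$ (i,k)\<close>, which for a zero pivot
        is \<open>piv\<close>. For \<open>j < k\<close> both sides only have the old sum.\<close>
      show ?thesis
        using False A sum ij k piv[of i] unfolding mins
        by (cases j k rule: linorder_cases; cases "W $$ (k,k) = 0") (simp_all add: E lu_entry_def)
    qed
  qed (use lu in \<open>auto simp: partial_lu_def eliminated_def\<close>)
qed

text \<open>The invariant survives zero pivots, so the loop yields a factorization for singular
  \<open>A\<close> too; nonzero pivots are derived afterwards from the determinant.\<close>

lemma computes_lu_factor:
  assumes "A \<in> carrier_mat N N"
  shows "computes (lu_factor N A) (\<Sum>m<N. m * (1 + 2 * m)) (\<lambda>(W, p). partial_lu N A N W p)"
proof -
  have "computes (lu_factor N A) (\<Sum>k=0..<N. (N - Suc k) * (1 + 2 * (N - Suc k)))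
    (\<lambda>(W, p). partial_lu N A N W p)"
    unfolding lu_factor_def
  proof (rule computes_for_loop_upt[where P = "\<lambda>k (W, p). partial_lu N A k W p"], goal_cases)
    case 2
    show ?case
      using assms by (simp add: partial_lu_def permutes_id)
  next
    case (3 k Wp)
    obtain W p where Wp: "Wp = (W, p)" by fastforce
    let ?r = "pivot_row N W k"
    let ?W = "swaprows k ?r W"
    from 3 Wp have lu: "partial_lu N A k W p" and k: "k < N" by auto
    have W: "W \<in> carrier_mat N N" using lu by (simp add: partial_lu_def)
    have "partial_lu N A k ?W (p(k := p ?r, ?r := p k))"
      using lu pivot_row[OF k] by (intro partial_lu_swaprows) auto
    \<comment> \<open>After the swap the pivot has the largest modulus in column \<open>k\<close>
      from row \<open>k\<close> on, so a zero pivot forces zeros below it.\<close>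
    moreover have "?W $$ (i,k) = 0" if "k < i" "i < N" "?W $$ (k,k) = 0" for i
      using that W k pivot_row(3)[OF k, of k W] pivot_row(3)[OF k, of i W] by (auto split: if_splits)
    ultimately have "partial_lu N A (Suc k) (eliminated N k ({k<..<N} \<times> {k..<N}) ?W) (p(k := p ?r, ?r := p k))"
      using k by (intro partial_lu_eliminated) auto
    then show ?case
      unfolding Wp Let_def case_prod_conv
      using k W
      by (intro computes_bind[where n' = 0, OF computes_eliminate_rows]) (auto intro!: computes_return)
  qed simp
  moreover have "(\<Sum>k=0..<N. (N - Suc k) * (1 + 2 * (N - Suc k))) = (\<Sum>m<N. m * (1 + 2 * m))"
    unfolding atLeast0LessThan by (rule sum.nat_diff_reindex)
  ultimately show ?thesis by simp
qed

text \<open>At \<open>k = N\<close> the invariant says that row \<open>p i\<close> of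
  \<open>A\<close> is row \<open>i\<close> of the product of the two factors. Exchanging the sums
  evaluates the upper factor at \<open>x\<close> first, giving \<open>y\<close>, and then the lower
  one at \<open>y\<close>, giving \<open>b $ p i\<close>. Since \<open>p\<close> is a permutation,
  this covers every row.\<close>

lemma partial_lu_solve:
  assumes A: "A \<in> carrier_mat N N" and lu: "partial_lu N A N W p"
    and b: "b \<in> carrier_vec N" and y: "y \<in> carrier_vec N" and x: "x \<in> carrier_vec N"
    and Ly: "\<And>i. i < N \<Longrightarrow> (\<Sum>j<i. W $$ (i,j) * y $ j) + y $ i = b $ p i"
    and Ux: "\<And>i. i < N \<Longrightarrow> (\<Sum>j=i..<N. W $$ (i,j) * x $ j) = y $ i"
  shows "A *\<^sub>v x = b"
proof -
  have p: "p permutes {0..<N}" using lu by (simp add: partial_lu_def)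
  let ?U = "\<lambda>i j. if i \<le> j then W $$ (i,j) else 0"
  have Uy: "(\<Sum>j<N. ?U i j * x $ j) = y $ i" if "i < N" for i
  proof -
    have "(\<Sum>j<N. ?U i j * x $ j) = (\<Sum>j=i..<N. ?U i j * x $ j)"
      by (rule sum.mono_neutral_right) auto
    also have "\<dots> = (\<Sum>j=i..<N. W $$ (i,j) * x $ j)"
      by (rule sum.cong) auto
    finally show ?thesis using Ux[OF that] by simp
  qed
  have row: "(A *\<^sub>v x) $ p i = b $ p i" if i: "i < N" for i
  proof -
    have pi: "p i < N" using permutes_in_image[OF p, of i] i by simp
    have "(A *\<^sub>v x) $ p i = (\<Sum>j<N. A $$ (p i, j) * x $ j)"
      using A x pi by (simp add: scalar_prod_def atLeast0LessThan)
    also have "\<dots> = (\<Sum>j<N. ((\<Sum>m<i. W $$ (i,m) * ?U m j) + ?U i j) * x $ j)"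
      using lu i by (intro sum.cong) (auto simp: partial_lu_def)
    also have "\<dots> = (\<Sum>j<N. \<Sum>m<i. W $$ (i,m) * (?U m j * x $ j)) + (\<Sum>j<N. ?U i j * x $ j)"
      by (simp only: distrib_right sum.distrib sum_distrib_right mult.assoc)
    also have "(\<Sum>j<N. \<Sum>m<i. W $$ (i,m) * (?U m j * x $ j)) = (\<Sum>m<i. W $$ (i,m) * (\<Sum>j<N. ?U m j * x $ j))"
      unfolding sum_distrib_left by (rule sum.swap)
    also have "\<dots> = (\<Sum>m<i. W $$ (i,m) * y $ m)"
    proof (rule sum.cong[OF refl])
      fix m assume "m \<in> {..<i}"
      then show "W $$ (i,m) * (\<Sum>j<N. ?U m j * x $ j) = W $$ (i,m) * y $ m"
        using Uy[of m] i by simp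
    qed
    also have "\<dots> + (\<Sum>j<N. ?U i j * x $ j) = b $ p i"
      unfolding Uy[OF i] by (rule Ly[OF i])
    finally show ?thesis .
  qed
  show ?thesis
  proof (rule eq_vecI)
    fix i assume "i < dim_vec b"
    then have "i < N" using b by simp
    then obtain i' where "i = p i'" "i' < N"
      using permutes_image[OF p] by (metis atLeastLessThan_iff image_iff le0)
    then show "(A *\<^sub>v x) $ i = b $ i" using row by simp
  qed (use A b in auto)
qed

text \<open>Back substitution divides by these entries. Permuting rows changes \<open>det A\<close>
  only by a sign, so the determinant of the upper factor, the product of its diagonal, cannot
  vanish.\<close>

lemma partial_lu_pivot_nonzero:
  assumes A: "A \<in> carrier_mat N N" and lu: "partial_lu N A N W p" and det: "det A \<noteq> 0" and "i < N"
  shows "W $$ (i,i) \<noteq> 0"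
proof -
  have W: "W \<in> carrier_mat N N" and p: "p permutes {0..<N}"
    using lu by (auto simp: partial_lu_def)
  let ?L = "mat N N (\<lambda>(i,m). if m < i then W $$ (i,m) else if m = i then 1 else 0)"
  let ?U = "mat N N (\<lambda>(m,j). if m \<le> j then W $$ (m,j) else 0)"
  have "mat N N (\<lambda>(i,j). A $$ (p i, j)) = ?L * ?U"
  proof (rule eq_matI)
    fix i j assume "i < dim_row (?L * ?U)" "j < dim_col (?L * ?U)"
    then have ij: "i < N" "j < N" by auto
    have "(?L * ?U) $$ (i,j) = (\<Sum>m<N. ?L $$ (i,m) * ?U $$ (m,j))"
      using ij by (simp add: scalar_prod_def atLeast0LessThan)
    also have "\<dots> = (\<Sum>m<Suc i. ?L $$ (i,m) * ?U $$ (m,j))"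
      using ij by (intro sum.mono_neutral_right) auto
    also have "\<dots> = (\<Sum>m<i. W $$ (i,m) * (if m \<le> j then W $$ (m,j) else 0)) + (if i \<le> j then W $$ (i,j) else 0)"
      using ij by (auto intro!: sum.cong)
    also have "\<dots> = A $$ (p i, j)"
      using lu ij by (simp add: partial_lu_def)
    finally show "mat N N (\<lambda>(i,j). A $$ (p i, j)) $$ (i,j) = (?L * ?U) $$ (i,j)"
      using ij by simp
  qed auto
  then have "signof p * det A = det ?L * det ?U"
    using det_permute_rows[OF A p] det_mult[of ?L N ?U] by simp
  moreover have "signof p * det A \<noteq> 0"
    using det by (simp add: sign_def)
  ultimately have "det ?U \<noteq> 0"
    by (auto simp only: mult_zero_right)
  moreover have "det ?U = prod_list (diag_mat ?U)"
    by (rule det_upper_triangular) auto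
  ultimately have "0 \<notin> set (diag_mat ?U)"
    by (simp only: prod_list_zero_iff simp_thms)
  then show ?thesis
    using \<open>i < N\<close> by (auto simp: diag_mat_def image_iff)
qed

lemma computes_lu_solve:
  assumes A: "A \<in> carrier_mat N N" and b: "b \<in> carrier_vec N" and det: "det A \<noteq> 0"
  shows "computes (lu_solve N A b) ((\<Sum>m<N. m * (1 + 2 * m)) + (\<Sum>i<N. 2 * i) + N ^ 2)
    (\<lambda>x. x \<in> carrier_vec N \<and> A *\<^sub>v x = b)"
  unfolding lu_solve_def
proof (rule computes_bind[OF computes_lu_factor[OF A]])
  fix Wp assume "case Wp of (W, p) \<Rightarrow> partial_lu N A N W p"
  then have lu: "partial_lu N A N (fst Wp) (snd Wp)" by (simp add: case_prod_beta)
  show "computes (do { y \<leftarrow> forward_subst N (fst Wp) (vec N (\<lambda>i. b $ snd Wp i)); back_subst N (fst Wp) y })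
     ((\<Sum>i<N. 2 * i) + N ^ 2) (\<lambda>x. x \<in> carrier_vec N \<and> A *\<^sub>v x = b)"
  proof (rule computes_bind[OF computes_forward_subst])
    fix y assume y: "y \<in> carrier_vec N \<and>
      (\<forall>i<N. (\<Sum>j<i. fst Wp $$ (i,j) * y $ j) + y $ i = vec N (\<lambda>i. b $ snd Wp i) $ i)"
    show "computes (back_subst N (fst Wp) y) (N ^ 2) (\<lambda>x. x \<in> carrier_vec N \<and> A *\<^sub>v x = b)"
    proof (rule computes_mono[OF computes_back_subst])
      fix x assume "x \<in> carrier_vec N \<and> (\<forall>i<N. (\<Sum>j=i..<N. fst Wp $$ (i,j) * x $ j) = y $ i)"
      then show "x \<in> carrier_vec N \<and> A *\<^sub>v x = b"
        using y by (auto intro!: partial_lu_solve[OF A lu b, of y])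
    qed (use y partial_lu_pivot_nonzero[OF A lu det] in auto)
  qed auto
qed simp

section \<open>The block system and its Schur complement\<close>

lemma append_cols_carrier [simp, intro]:
  "A \<in> carrier_mat n m1 \<Longrightarrow> B \<in> carrier_mat n m2 \<Longrightarrow> A @\<^sub>c B \<in> carrier_mat n (m1 + m2)"
  unfolding append_cols_def carrier_mat_def by auto

lemma append_cols_mult_vec:
  assumes A: "A \<in> carrier_mat n m1" and B: "B \<in> carrier_mat n m2"
    and v: "v \<in> carrier_vec m1" and w: "w \<in> carrier_vec m2"
  shows "(A @\<^sub>c B) *\<^sub>v (v @\<^sub>v w) = A *\<^sub>v v + B *\<^sub>v (w :: 'a :: comm_ring_1 vec)"
proof -
  \<comment> \<open>The lower blocks have no rows, so the appended second part is a vector of length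
    0.\<close>
  have "(A @\<^sub>c B) *\<^sub>v (v @\<^sub>v w) =
    (A *\<^sub>v v + B *\<^sub>v w) @\<^sub>v (0\<^sub>m 0 m1 *\<^sub>v v + 0\<^sub>m 0 m2 *\<^sub>v w)"
    unfolding append_cols_def using assms by (intro trans[OF four_block_mat_mult_vec[OF A B _ _ v w]]) auto
  also have "\<dots> = A *\<^sub>v v + B *\<^sub>v w"
    using assms by (intro eq_vecI) auto
  finally show ?thesis .
qed

lemma block_system_mat_carrier:
  assumes "M13 \<in> carrier_mat N N" "M23 \<in> carrier_mat N N" "M31 \<in> carrier_mat N N" "M32 \<in> carrier_mat N N"
  shows "block_system_mat N M13 M23 M31 M32 \<in> carrier_mat (N + (N + N)) (N + (N + N))"
  unfolding block_system_mat_def using assms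
  by (intro carrier_append_rows append_cols_carrier) auto

lemma block_system_mat_mult_vec:
  assumes M: "M13 \<in> carrier_mat N N" "M23 \<in> carrier_mat N N" "M31 \<in> carrier_mat N N" "M32 \<in> carrier_mat N N"
    and v: "u \<in> carrier_vec N" "q \<in> carrier_vec N" "\<phi> \<in> carrier_vec N"
  shows "block_system_mat N M13 M23 M31 M32 *\<^sub>v (u @\<^sub>v q @\<^sub>v \<phi>) =
    (u + M13 *\<^sub>v \<phi>) @\<^sub>v (q + M23 *\<^sub>v \<phi>) @\<^sub>v (M31 *\<^sub>v u + M32 *\<^sub>v q)"
proof -
  let ?w = "u @\<^sub>v q @\<^sub>v \<phi>"
  have row: "(X @\<^sub>c Y @\<^sub>c Z) *\<^sub>v ?w = X *\<^sub>v u + (Y *\<^sub>v q + Z *\<^sub>v \<phi>)"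
    if "X \<in> carrier_mat N N" "Y \<in> carrier_mat N N" "Z \<in> carrier_mat N N" for X Y Z
    using that v
    by (simp add: append_cols_mult_vec[of X N N _ "N + N"] append_cols_mult_vec[of Y N N _ N]
        append_cols_carrier)
  have c: "X @\<^sub>c Y @\<^sub>c Z \<in> carrier_mat N (N + (N + N))"
    if "X \<in> carrier_mat N N" "Y \<in> carrier_mat N N" "Z \<in> carrier_mat N N" for X Y Z :: "complex mat"
    using that by auto
  have w: "?w \<in> carrier_vec (N + (N + N))"
    using v by auto
  have [simp]: "0\<^sub>m N N *\<^sub>v a = 0\<^sub>v N" if "a \<in> carrier_vec N" for a :: "complex vec"
    using that by (intro eq_vecI) auto
  show ?thesis
    unfolding block_system_mat_def
    using M v by (subst mat_mult_append[OF c carrier_append_rows[OF c c] w], simp_all,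
        subst mat_mult_append[OF c c w], simp_all add: row)
qed

lemma uminus_mult_mat_vec:
  assumes "A \<in> carrier_mat n m" "v \<in> carrier_vec m"
  shows "(- A) *\<^sub>v v = - (A *\<^sub>v (v :: 'a :: comm_ring_1 vec))"
  using assms by (intro eq_vecI) (auto simp: scalar_prod_def sum_negf)

lemma add_eq_zero_vec_iff:
  assumes "u \<in> carrier_vec n" "v \<in> carrier_vec n"
  shows "u + v = 0\<^sub>v n \<longleftrightarrow> u = - (v :: 'a :: ab_group_add vec)"
  using assms by (auto simp: vec_eq_iff eq_neg_iff_add_eq_0)

text \<open>The right-hand side \<open>b\<close> is kept general because the equivalence serves
  twice: with \<open>b3\<close> for the solution formula and with zero for the kernel of the block
  matrix.\<close>

lemma block_system_iff_schur:
  assumes M: "M13 \<in> carrier_mat N N" "M23 \<in> carrier_mat N N" "M31 \<in> carrier_mat N N" "M32 \<in> carrier_mat N N"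
    and v: "u \<in> carrier_vec N" "q \<in> carrier_vec N" "\<phi> \<in> carrier_vec N" and b: "b \<in> carrier_vec N"
  shows "block_system_mat N M13 M23 M31 M32 *\<^sub>v (u @\<^sub>v q @\<^sub>v \<phi>) = 0\<^sub>v N @\<^sub>v 0\<^sub>v N @\<^sub>v b \<longleftrightarrow>
    u = - (M13 *\<^sub>v \<phi>) \<and> q = - (M23 *\<^sub>v \<phi>) \<and> (- (M31 * M13) - M32 * M23) *\<^sub>v \<phi> = b"
proof -
  have K: "M31 *\<^sub>v (- (M13 *\<^sub>v \<phi>)) + M32 *\<^sub>v (- (M23 *\<^sub>v \<phi>)) = (- (M31 * M13) - M32 * M23) *\<^sub>v \<phi>"
  proof -
    have "(- (M31 * M13) - M32 * M23) *\<^sub>v \<phi> = (- (M31 * M13)) *\<^sub>v \<phi> - (M32 * M23) *\<^sub>v \<phi>"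
      by (rule minus_mult_distrib_mat_vec) (use M v in auto)
    also have "\<dots> = - (M31 *\<^sub>v (M13 *\<^sub>v \<phi>)) - M32 *\<^sub>v (M23 *\<^sub>v \<phi>)"
      using M v by (simp add: uminus_mult_mat_vec[of _ N N])
    also have "\<dots> = M31 *\<^sub>v (- (M13 *\<^sub>v \<phi>)) + M32 *\<^sub>v (- (M23 *\<^sub>v \<phi>))"
      using M v by (intro eq_vecI) auto
    finally show ?thesis by simp
  qed
  have "block_system_mat N M13 M23 M31 M32 *\<^sub>v (u @\<^sub>v q @\<^sub>v \<phi>) = 0\<^sub>v N @\<^sub>v 0\<^sub>v N @\<^sub>v b \<longleftrightarrow>
    u + M13 *\<^sub>v \<phi> = 0\<^sub>v N \<and> q + M23 *\<^sub>v \<phi> = 0\<^sub>v N \<and> M31 *\<^sub>v u + M32 *\<^sub>v q = b"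
    unfolding block_system_mat_mult_vec[OF M v]
    using M v b by (subst append_vec_eq[of _ N], simp_all, subst append_vec_eq[of _ N], simp_all)
  then show ?thesis
    using M v K by (auto simp: add_eq_zero_vec_iff[of _ N])
qed

section \<open>Invertibility and the inverse matrix\<close>

lemma invertible_mat_iff_det_nonzero:
  fixes A :: "'a :: field mat"
  assumes A: "A \<in> carrier_mat n n"
  shows "invertible_mat A \<longleftrightarrow> det A \<noteq> 0"
proof
  assume "invertible_mat A"
  then obtain B where AB: "A * B = 1\<^sub>m n" and BA: "B * A = 1\<^sub>m (dim_row B)"
    using A by (auto simp: invertible_mat_def inverts_mat_def)
  \<comment> \<open>\<open>invertible_mat\<close> does not give the dimensions of \<open>B\<close>;
    comparing column counts in the two identities does.\<close>
  have B: "B \<in> carrier_mat n n"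
    using arg_cong[OF AB, of dim_col] arg_cong[OF BA, of dim_col] A by auto
  have "det A * det B = 1"
    using det_mult[OF A B] AB by simp
  then show "det A \<noteq> 0" by auto
next
  assume "det A \<noteq> 0"
  then obtain B where "A * B = 1\<^sub>m n" "B * A = 1\<^sub>m n" "B \<in> carrier_mat n n"
    using det_non_zero_imp_unit[OF A] by (auto simp: Units_def ring_mat_def)
  then show "invertible_mat A"
    using A by (auto simp: invertible_mat_def inverts_mat_def intro!: exI[of _ B])
qed

lemma mat_inverse_mult_vec_eq_iff:
  fixes A :: "'a :: field mat"
  assumes A: "A \<in> carrier_mat n n" and det: "det A \<noteq> 0"
    and b: "b \<in> carrier_vec n" and x: "x \<in> carrier_vec n"
  shows "A *\<^sub>v x = b \<longleftrightarrow> x = the (mat_inverse A) *\<^sub>v b"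
    and "the (mat_inverse A) *\<^sub>v b \<in> carrier_vec n"
proof -
  \<comment> \<open>\<open>mat_inverse\<close> returns \<open>None\<close> only for a non-unit,
    which the determinant excludes. The unit value instantiates the extra parameter of
    \<open>ring_mat\<close>.\<close>
  obtain B where B: "mat_inverse A = Some B"
    using mat_inverse(1)[OF A, where b = "()"] det_non_zero_imp_unit[OF A det, where b = "()"]
    by (cases "mat_inverse A") auto
  note inv = mat_inverse(2)[OF A B]
  show "A *\<^sub>v x = b \<longleftrightarrow> x = the (mat_inverse A) *\<^sub>v b"
    using inv A b x B assoc_mult_mat_vec[of A n n B n b] assoc_mult_mat_vec[of B n n A n x] by auto
  show "the (mat_inverse A) *\<^sub>v b \<in> carrier_vec n"
    using inv B b by auto
qed

lemma det_schur_nonzero: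
  assumes M: "M13 \<in> carrier_mat N N" "M23 \<in> carrier_mat N N" "M31 \<in> carrier_mat N N" "M32 \<in> carrier_mat N N"
    and inv: "invertible_mat (block_system_mat N M13 M23 M31 M32)"
  shows "det (- (M31 * M13) - M32 * M23) \<noteq> 0"
proof
  let ?A = "block_system_mat N M13 M23 M31 M32"
  let ?K = "- (M31 * M13) - M32 * M23"
  have K: "?K \<in> carrier_mat N N" using M by auto
  note A = block_system_mat_carrier[OF M]
  assume "det ?K = 0"
  then obtain v where v: "v \<in> carrier_vec N" "v \<noteq> 0\<^sub>v N" "?K *\<^sub>v v = 0\<^sub>v N"
    using det_0_iff_vec_prod_zero_field[OF K] by auto
  \<comment> \<open>The first two block rows force these components once the third is
    \<open>v\<close>; the third keeps the vector nonzero.\<close>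
  let ?w = "(- (M13 *\<^sub>v v)) @\<^sub>v (- (M23 *\<^sub>v v)) @\<^sub>v v"
  have zero: "(0\<^sub>v (N + (N + N)) :: complex vec) = 0\<^sub>v N @\<^sub>v 0\<^sub>v N @\<^sub>v 0\<^sub>v N"
    by (intro eq_vecI) auto
  have "?A *\<^sub>v ?w = 0\<^sub>v (N + (N + N))"
    unfolding zero using block_system_iff_schur[OF M _ _ v(1), of "- (M13 *\<^sub>v v)" "- (M23 *\<^sub>v v)" "0\<^sub>v N"] M v by auto
  moreover have "?w \<noteq> 0\<^sub>v (N + (N + N))"
    unfolding zero using M v by (auto simp: append_vec_eq[of _ N])
  moreover have "?w \<in> carrier_vec (N + (N + N))"
    using M v by auto
  ultimately have "det ?A = 0"
    using det_0_iff_vec_prod_zero_field[OF A] by blast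
  then show False
    using inv invertible_mat_iff_det_nonzero[OF A] by simp
qed

section \<open>Correctness and cost of the whole procedure\<close>

lemma computes_solution_procedure:
  assumes M: "M13 \<in> carrier_mat N N" "M23 \<in> carrier_mat N N" "M31 \<in> carrier_mat N N" "M32 \<in> carrier_mat N N"
    and b: "b \<in> carrier_vec N" and det: "det (- (M31 * M13) - M32 * M23) \<noteq> 0"
  defines "x \<equiv> the (mat_inverse (- (M31 * M13) - M32 * M23)) *\<^sub>v b"
  shows "computes (solution_procedure N M13 M23 M31 M32 b)
    (4 * N ^ 3 + 7 * N ^ 2 + 2 * N + (\<Sum>m<N. m * (1 + 2 * m)) + (\<Sum>i<N. 2 * i))
    (\<lambda>r. r = (- (M13 *\<^sub>v x), - (M23 *\<^sub>v x), x))"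
proof -
  let ?K = "- (M31 * M13) - M32 * M23"
  have K: "?K \<in> carrier_mat N N" using M by auto
  have x: "x \<in> carrier_vec N"
    unfolding x_def by (rule mat_inverse_mult_vec_eq_iff(2)[OF K det b b])
  \<comment> \<open>Uniqueness of the solution turns the relational result of
    \<open>lu_solve\<close> into an equality with \<open>x\<close>.\<close>
  have solve: "computes (lu_solve N ?K b) ((\<Sum>m<N. m * (1 + 2 * m)) + (\<Sum>i<N. 2 * i) + N ^ 2) (\<lambda>y. y = x)"
    by (rule computes_mono[OF computes_lu_solve[OF K b det]])
      (use mat_inverse_mult_vec_eq_iff(1)[OF K det b] in \<open>auto simp: x_def\<close>)
  \<comment> \<open>The products give \<open>4 * N ^ 3\<close>. The term \<open>7 * N ^ 2\<close>
    collects 2 from forming the Schur complement, 1 from back substitution and 2 from each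
    matrix-vector product; \<open>2 * N\<close> counts their negations. The sums belong to the
    factorization and the forward solve.\<close>
  show ?thesis
    unfolding solution_procedure_def
    apply (rule computes_bind[OF computes_mat_mul[OF M(3,1)]], hypsubst)
     apply (rule computes_bind[OF computes_mat_mul[OF M(4,2)]], hypsubst)
      apply (rule computes_bind[OF computes_neg_sub_mat], (use M in auto)[2], hypsubst)
       apply (rule computes_bind[OF solve], hypsubst)
        apply (rule computes_bind[OF computes_neg_mat_vec_mul[OF M(1) x]], hypsubst)
         apply (rule computes_bind[OF computes_neg_mat_vec_mul[OF M(2) x]], hypsubst)
          apply (rule computes_return, rule refl)
         apply (rule refl)+
    by simp
qed

lemma solution_procedure_flops_asymp:
  "(\<lambda>N. real (4 * N ^ 3 + 7 * N ^ 2 + 2 * N + (\<Sum>m<N. m * (1 + 2 * m)) + (\<Sum>i<N. 2 * i)))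
     \<sim>[at_top] (\<lambda>N. 14/3 * real N ^ 3)"
proof -
  have lu: "real (\<Sum>m<N. m * (1 + 2 * m)) = 2/3 * real N ^ 3 - 1/2 * real N ^ 2 - 1/6 * real N" for N
    by (induction N) (simp_all add: field_simps power2_eq_square power3_eq_cube)
  have subst: "real (\<Sum>i<N. 2 * i) = real N ^ 2 - real N" for N
    by (induction N) (simp_all add: field_simps power2_eq_square)
  have "real (4 * N ^ 3 + 7 * N ^ 2 + 2 * N + (\<Sum>m<N. m * (1 + 2 * m)) + (\<Sum>i<N. 2 * i)) =
    14/3 * real N ^ 3 + 15/2 * real N ^ 2 + 5/6 * real N" for N
    unfolding of_nat_add lu subst by simp
  then show ?thesis
    by (simp only:) real_asymp
qed

theorem theorem4p1:
  "\<exists>flop_count :: nat \<Rightarrow> nat.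
    (\<forall>(N::nat) (\<epsilon>\<^sub>0::real) (\<epsilon>\<^sub>1::real) (\<beta>::complex)
      (S\<^sub>0::complex mat) (S\<^sub>1::complex mat) (D\<^sub>0::complex mat)
      (Ds\<^sub>0::complex mat) (Ds\<^sub>1::complex mat) (N\<^sub>0::complex mat)
      (uin::complex vec) (qin::complex vec).
      N \<ge> 1 \<longrightarrow> \<epsilon>\<^sub>0 > 0 \<longrightarrow> \<epsilon>\<^sub>1 > 0 \<longrightarrow> Im \<beta> \<noteq> 0 \<longrightarrow>
      S\<^sub>0 \<in> carrier_mat N N \<longrightarrow> S\<^sub>1 \<in> carrier_mat N N \<longrightarrow> D\<^sub>0 \<in> carrier_mat N N \<longrightarrow>
      Ds\<^sub>0 \<in> carrier_mat N N \<longrightarrow> Ds\<^sub>1 \<in> carrier_mat N N \<longrightarrow> N\<^sub>0 \<in> carrier_mat N N \<longrightarrow>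
      uin \<in> carrier_vec N \<longrightarrow> qin \<in> carrier_vec N \<longrightarrow>
      (let M13 = - S\<^sub>1;
           M23 = (- 1 / complex_of_real \<epsilon>\<^sub>1) \<cdot>\<^sub>m (Ds\<^sub>1 + (1/2) \<cdot>\<^sub>m 1\<^sub>m N);
           M31 = D\<^sub>0 - (1/2) \<cdot>\<^sub>m 1\<^sub>m N + \<beta> \<cdot>\<^sub>m N\<^sub>0;
           M32 = (- complex_of_real \<epsilon>\<^sub>0) \<cdot>\<^sub>m (S\<^sub>0 + \<beta> \<cdot>\<^sub>m (Ds\<^sub>0 + (1/2) \<cdot>\<^sub>m 1\<^sub>m N));
           b3 = - uin - \<beta> \<cdot>\<^sub>v qin;
           A = block_system_mat N M13 M23 M31 M32;
           K = - (M31 * M13) - M32 * M23;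
           x3 = the (mat_inverse K) *\<^sub>v b3
       in invertible_mat A \<longrightarrow>
            invertible_mat K \<and>
            (\<forall>u \<in> carrier_vec N. \<forall>q \<in> carrier_vec N. \<forall>\<phi> \<in> carrier_vec N.
               A *\<^sub>v (u @\<^sub>v q @\<^sub>v \<phi>) = 0\<^sub>v N @\<^sub>v 0\<^sub>v N @\<^sub>v b3 \<longleftrightarrow>
               u = - (M13 *\<^sub>v x3) \<and> q = - (M23 *\<^sub>v x3) \<and> \<phi> = x3) \<and>
            run_state (solution_procedure N M13 M23 M31 M32 b3) 0 =
              ((- (M13 *\<^sub>v x3), - (M23 *\<^sub>v x3), x3), flop_count N))) \<and>
    (\<lambda>N. real (flop_count N)) \<sim>[at_top] (\<lambda>N. 14/3 * real N ^ 3)"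
proof (intro exI conjI allI impI)
  \<comment> \<open>This goal fixes the witness for \<open>flop_count\<close>: the exact cost, a
    function of \<open>N\<close> alone and so the same for all admissible data.\<close>
  show "(\<lambda>N. real (4 * N ^ 3 + 7 * N ^ 2 + 2 * N + (\<Sum>m<N. m * (1 + 2 * m)) + (\<Sum>i<N. 2 * i)))
     \<sim>[at_top] (\<lambda>N. 14/3 * real N ^ 3)"
    by (rule solution_procedure_flops_asymp)
next
  fix N :: nat and \<epsilon>\<^sub>0 \<epsilon>\<^sub>1 :: real and \<beta> :: complex
    and S\<^sub>0 S\<^sub>1 D\<^sub>0 Ds\<^sub>0 Ds\<^sub>1 N\<^sub>0 :: "complex mat" and uin qin :: "complex vec"
  assume C: "S\<^sub>0 \<in> carrier_mat N N" "S\<^sub>1 \<in> carrier_mat N N" "D\<^sub>0 \<in> carrier_mat N N"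
    "Ds\<^sub>0 \<in> carrier_mat N N" "Ds\<^sub>1 \<in> carrier_mat N N" "N\<^sub>0 \<in> carrier_mat N N"
    "uin \<in> carrier_vec N" "qin \<in> carrier_vec N"
  define M13 where "M13 = - S\<^sub>1"
  define M23 where "M23 = (- 1 / complex_of_real \<epsilon>\<^sub>1) \<cdot>\<^sub>m (Ds\<^sub>1 + (1/2) \<cdot>\<^sub>m 1\<^sub>m N)"
  define M31 where "M31 = D\<^sub>0 - (1/2) \<cdot>\<^sub>m 1\<^sub>m N + \<beta> \<cdot>\<^sub>m N\<^sub>0"
  define M32 where "M32 = (- complex_of_real \<epsilon>\<^sub>0) \<cdot>\<^sub>m (S\<^sub>0 + \<beta> \<cdot>\<^sub>m (Ds\<^sub>0 + (1/2) \<cdot>\<^sub>m 1\<^sub>m N))"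
  define b3 where "b3 = - uin - \<beta> \<cdot>\<^sub>v qin"
  note defs = M13_def M23_def M31_def M32_def b3_def
  have M: "M13 \<in> carrier_mat N N" "M23 \<in> carrier_mat N N" "M31 \<in> carrier_mat N N" "M32 \<in> carrier_mat N N"
    and b: "b3 \<in> carrier_vec N"
    using C by (auto simp: defs)
  show "let M13 = - S\<^sub>1;
           M23 = (- 1 / complex_of_real \<epsilon>\<^sub>1) \<cdot>\<^sub>m (Ds\<^sub>1 + (1/2) \<cdot>\<^sub>m 1\<^sub>m N);
           M31 = D\<^sub>0 - (1/2) \<cdot>\<^sub>m 1\<^sub>m N + \<beta> \<cdot>\<^sub>m N\<^sub>0;
           M32 = (- complex_of_real \<epsilon>\<^sub>0) \<cdot>\<^sub>m (S\<^sub>0 + \<beta> \<cdot>\<^sub>m (Ds\<^sub>0 + (1/2) \<cdot>\<^sub>m 1\<^sub>m N));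
           b3 = - uin - \<beta> \<cdot>\<^sub>v qin;
           A = block_system_mat N M13 M23 M31 M32;
           K = - (M31 * M13) - M32 * M23;
           x3 = the (mat_inverse K) *\<^sub>v b3
       in invertible_mat A \<longrightarrow>
            invertible_mat K \<and>
            (\<forall>u \<in> carrier_vec N. \<forall>q \<in> carrier_vec N. \<forall>\<phi> \<in> carrier_vec N.
               A *\<^sub>v (u @\<^sub>v q @\<^sub>v \<phi>) = 0\<^sub>v N @\<^sub>v 0\<^sub>v N @\<^sub>v b3 \<longleftrightarrow>
               u = - (M13 *\<^sub>v x3) \<and> q = - (M23 *\<^sub>v x3) \<and> \<phi> = x3) \<and>
            run_state (solution_procedure N M13 M23 M31 M32 b3) 0 =
              ((- (M13 *\<^sub>v x3), - (M23 *\<^sub>v x3), x3),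
               4 * N ^ 3 + 7 * N ^ 2 + 2 * N + (\<Sum>m<N. m * (1 + 2 * m)) + (\<Sum>i<N. 2 * i))"
    unfolding Let_def defs[symmetric]
  proof (intro impI conjI ballI)
    assume "invertible_mat (block_system_mat N M13 M23 M31 M32)"
    note det = det_schur_nonzero[OF M this]
    have K: "- (M31 * M13) - M32 * M23 \<in> carrier_mat N N"
      using M by auto
    show "invertible_mat (- (M31 * M13) - M32 * M23)"
      using det invertible_mat_iff_det_nonzero[OF K] by simp
    show "run_state (solution_procedure N M13 M23 M31 M32 b3) 0 =
        ((- (M13 *\<^sub>v (the (mat_inverse (- (M31 * M13) - M32 * M23)) *\<^sub>v b3)),
          - (M23 *\<^sub>v (the (mat_inverse (- (M31 * M13) - M32 * M23)) *\<^sub>v b3)),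
          the (mat_inverse (- (M31 * M13) - M32 * M23)) *\<^sub>v b3),
         4 * N ^ 3 + 7 * N ^ 2 + 2 * N + (\<Sum>m<N. m * (1 + 2 * m)) + (\<Sum>i<N. 2 * i))"
      using computes_eqD[OF computes_solution_procedure[OF M b det], of 0] by simp
    fix u q \<phi> :: "complex vec"
    assume v: "u \<in> carrier_vec N" "q \<in> carrier_vec N" "\<phi> \<in> carrier_vec N"
    show "block_system_mat N M13 M23 M31 M32 *\<^sub>v (u @\<^sub>v q @\<^sub>v \<phi>) = 0\<^sub>v N @\<^sub>v 0\<^sub>v N @\<^sub>v b3 \<longleftrightarrow>
      u = - (M13 *\<^sub>v (the (mat_inverse (- (M31 * M13) - M32 * M23)) *\<^sub>v b3)) \<and>
      q = - (M23 *\<^sub>v (the (mat_inverse (- (M31 * M13) - M32 * M23)) *\<^sub>v b3)) \<and>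
      \<phi> = the (mat_inverse (- (M31 * M13) - M32 * M23)) *\<^sub>v b3"
      \<comment> \<open>The Schur equation becomes the equality of \<phi> with the inverse applied
        to \<open>b3\<close>, which may then replace \<phi> in the other two equations.\<close>
      unfolding block_system_iff_schur[OF M v b] mat_inverse_mult_vec_eq_iff(1)[OF K det b v(3)]
      by auto
  qed
qed

end
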